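(* Let $X$ be a $k$-step LCH nilspace and let $Y$ be a $k$-step Lie-fibered nilspace. Then every continuous fibration $\varphi:X\to Y$ is an open map.
   Context: Nilspaces: $\{0,1\}^n$ discrete cube; discrete-cube morphisms have coordinate functions $v\mapsto0,1,v_j,1-v_j$. A nilspace is a set $X$ with sets $C^n(X)\subseteq X^{\{0,1\}^n}$ of $n$-cubes closed under composition with discrete-cube morphisms, $C^1(X)=X^{\{0,1\}}$, and every $n$-corner (a map on $\{0,1\}^n\setminus\{1^n\}$ whose restrictions to the $(n-1)$-faces containing $0^n$ are cubes) extends to a cube; $k$-step if $(k+1)$-corners extend uniquely. A morphism sends cubes to cubes; a fibration $\varphi:X\to Y$ is a morphism such that whenever $\lambda$ is an $n$-corner on $X$ and $c\in C^n(Y)$ extends $\varphi\circ\lambda$, there is $c'\in C^n(X)$ extending $\lambda$ with $\varphi\circ c'=c$. Factors: $x\sim_iy$ iff there are $(i+1)$-cubes $c,c'$ with $c(0^{i+1})=x,c'(0^{i+1})=y$ agreeing elsewhere; $X_i=X/\!\sim_i$; for $k$-step $X$ the fibres of $X_i\to X_{i-1}$ are orbits of a free action of an abelian group $Z_i$ (the $i$-th structure group). An LCH nilspace has a locally compact Hausdorff second-countable topology, each $C^n(X)$ closed in $X^{\{0,1\}^n}$, and the restriction map from $n$-cubes to $n$-corners open; factors carry the quotient topology and structure groups the subspace topology of a fibre. Lie-fibered: LCH with all structure groups compactly generated Lie groups. *)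

theory Defs
  imports "HOL-Analysis.Analysis" "HOL-Algebra.Group_Action" "HOL-Algebra.Generated_Groups"
    "HOL-Algebra.FiniteProduct"
begin

section \<open>Discrete cubes\<close>

definition cube :: "nat \<Rightarrow> bool list set" where
  "cube n = {v. length v = n}"

abbreviation zero_vertex :: "nat \<Rightarrow> bool list" where
  "zero_vertex n \<equiv> replicate n False"

abbreviation one_vertex :: "nat \<Rightarrow> bool list" where
  "one_vertex n \<equiv> replicate n True"

definition cube_morphism :: "nat \<Rightarrow> nat \<Rightarrow> (bool list \<Rightarrow> bool list) \<Rightarrow> bool" where
  "cube_morphism m n g \<longleftrightarrow>
     (\<forall>v\<in>cube m. g v \<in> cube n) \<and>
     (\<forall>j<n. (\<exists>b. \<forall>v\<in>cube m. g v ! j = b) \<or>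
            (\<exists>i<m. \<forall>v\<in>cube m. g v ! j = v ! i) \<or>
            (\<exists>i<m. \<forall>v\<in>cube m. g v ! j = (\<not> v ! i)))"

text \<open>Embedding of the \<open>(n-1)\<close>-cube onto the face \<open>v\<^sub>i = 0\<close> of the \<open>n\<close>-cube.\<close>

definition zero_face :: "nat \<Rightarrow> bool list \<Rightarrow> bool list" where
  "zero_face i w = take i w @ False # drop i w"

section \<open>Nilspaces\<close>

record 'a cubespace =
  points :: "'a set"
  cubes :: "nat \<Rightarrow> (bool list \<Rightarrow> 'a) set"

definition corners :: "'a cubespace \<Rightarrow> nat \<Rightarrow> (bool list \<Rightarrow> 'a) set" where
  "corners X n = {l \<in> (cube n - {one_vertex n}) \<rightarrow>\<^sub>E points X.
     \<forall>i<n. (\<lambda>w\<in>cube (n - 1). l (zero_face i w)) \<in> cubes X (n - 1)}"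

text \<open>Corners are only considered in dimension \<open>n \<ge> 1\<close>: for \<open>n = 0\<close> there are no
  \<open>(n-1)\<close>-faces.\<close>

definition nilspace :: "'a cubespace \<Rightarrow> bool" where
  "nilspace X \<longleftrightarrow>
     (\<forall>n. cubes X n \<subseteq> (cube n \<rightarrow>\<^sub>E points X)) \<and>
     (\<forall>m n g. \<forall>c\<in>cubes X n. cube_morphism m n g \<longrightarrow> (\<lambda>v\<in>cube m. c (g v)) \<in> cubes X m) \<and>
     cubes X 1 = (cube 1 \<rightarrow>\<^sub>E points X) \<and>
     (\<forall>n\<ge>1. \<forall>l\<in>corners X n. \<exists>c\<in>cubes X n. \<forall>v\<in>cube n - {one_vertex n}. c v = l v)"

definition step_nilspace :: "nat \<Rightarrow> 'a cubespace \<Rightarrow> bool" where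
  "step_nilspace k X \<longleftrightarrow> nilspace X \<and>
     (\<forall>l\<in>corners X (k + 1). \<exists>!c. c \<in> cubes X (k + 1) \<and>
        (\<forall>v\<in>cube (k + 1) - {one_vertex (k + 1)}. c v = l v))"

definition nil_morphism :: "'a cubespace \<Rightarrow> 'b cubespace \<Rightarrow> ('a \<Rightarrow> 'b) \<Rightarrow> bool" where
  "nil_morphism X Y f \<longleftrightarrow> f \<in> points X \<rightarrow> points Y \<and>
     (\<forall>n. \<forall>c\<in>cubes X n. (\<lambda>v\<in>cube n. f (c v)) \<in> cubes Y n)"

definition fibration :: "'a cubespace \<Rightarrow> 'b cubespace \<Rightarrow> ('a \<Rightarrow> 'b) \<Rightarrow> bool" where
  "fibration X Y f \<longleftrightarrow> nil_morphism X Y f \<and>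
     (\<forall>n\<ge>1. \<forall>l\<in>corners X n. \<forall>c\<in>cubes Y n.
        (\<forall>v\<in>cube n - {one_vertex n}. c v = f (l v)) \<longrightarrow>
        (\<exists>c'\<in>cubes X n. (\<forall>v\<in>cube n - {one_vertex n}. c' v = l v) \<and>
                        (\<forall>v\<in>cube n. f (c' v) = c v)))"

section \<open>Factors\<close>

definition nil_rel :: "'a cubespace \<Rightarrow> nat \<Rightarrow> ('a \<times> 'a) set" where
  "nil_rel X i = {(x, y). \<exists>c\<in>cubes X (i + 1). \<exists>c'\<in>cubes X (i + 1).
     c (zero_vertex (i + 1)) = x \<and> c' (zero_vertex (i + 1)) = y \<and>
     (\<forall>v\<in>cube (i + 1) - {zero_vertex (i + 1)}. c v = c' v)}"

definition factor :: "'a cubespace \<Rightarrow> nat \<Rightarrow> 'a set cubespace" where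
  "factor X i = \<lparr> points = points X // nil_rel X i,
     cubes = (\<lambda>n. (\<lambda>c. \<lambda>v\<in>cube n. nil_rel X i `` {c v}) ` cubes X n) \<rparr>"

text \<open>The projection of a factor of order \<open>\<ge> i\<close> onto the \<open>i\<close>-th factor: it sends a class to
  the coarser \<open>\<sim>\<^sub>i\<close>-class that contains it.\<close>

definition factor_proj :: "'a cubespace \<Rightarrow> nat \<Rightarrow> 'a set \<Rightarrow> 'a set" where
  "factor_proj X i A = nil_rel X i `` A"

definition factor_topology :: "'a cubespace \<Rightarrow> 'a topology \<Rightarrow> nat \<Rightarrow> 'a set topology" where
  "factor_topology X T i = topology (\<lambda>U. U \<subseteq> points X // nil_rel X i \<and>
     openin T {x \<in> topspace T. nil_rel X i `` {x} \<in> U})"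

lemma openin_factor_topology:
  "openin (factor_topology X T i) U \<longleftrightarrow> U \<subseteq> points X // nil_rel X i \<and>
     openin T {x \<in> topspace T. nil_rel X i `` {x} \<in> U}"
proof -
  let ?q = "\<lambda>x. nil_rel X i `` {x}"
  have "istopology (\<lambda>U. U \<subseteq> points X // nil_rel X i \<and> openin T {x \<in> topspace T. ?q x \<in> U})"
    unfolding istopology_def
  proof (intro conjI allI impI)
    fix U V
    assume U: "U \<subseteq> points X // nil_rel X i \<and> openin T {x \<in> topspace T. ?q x \<in> U}"
      and V: "V \<subseteq> points X // nil_rel X i \<and> openin T {x \<in> topspace T. ?q x \<in> V}"
    then show "U \<inter> V \<subseteq> points X // nil_rel X i" by blast
    have "{x \<in> topspace T. ?q x \<in> U \<inter> V} =
        {x \<in> topspace T. ?q x \<in> U} \<inter> {x \<in> topspace T. ?q x \<in> V}" by blast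
    then show "openin T {x \<in> topspace T. ?q x \<in> U \<inter> V}"
      using U V by (metis (lifting) openin_Int)
  next
    fix \<K>
    assume K: "\<forall>U\<in>\<K>. U \<subseteq> points X // nil_rel X i \<and> openin T {x \<in> topspace T. ?q x \<in> U}"
    then show "\<Union>\<K> \<subseteq> points X // nil_rel X i" by blast
    have "{x \<in> topspace T. ?q x \<in> \<Union>\<K>} = (\<Union>U\<in>\<K>. {x \<in> topspace T. ?q x \<in> U})" by blast
    then show "openin T {x \<in> topspace T. ?q x \<in> \<Union>\<K>}"
      using K by (metis (lifting) imageE openin_Union)
  qed
  then show ?thesis unfolding factor_topology_def by (simp add: topology_inverse')
qed

section \<open>Structure groups\<close>

text \<open>The \<open>n\<close>-cubes of the degree-\<open>k\<close> nilspace \<open>\<D>\<^sub>k(Z)\<close> of an abelian group \<open>Z\<close>: the maps all of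
  whose compositions with morphisms from the \<open>(k+1)\<close>-cube have vanishing alternating sum.\<close>

definition degree_cubes :: "('g, 'm) monoid_scheme \<Rightarrow> nat \<Rightarrow> nat \<Rightarrow> (bool list \<Rightarrow> 'g) set" where
  "degree_cubes Z k n = {d \<in> cube n \<rightarrow>\<^sub>E carrier Z. \<forall>g. cube_morphism (k + 1) n g \<longrightarrow>
     finprod Z (\<lambda>v. if even (count_list v True) then d (g v) else inv\<^bsub>Z\<^esub> (d (g v))) (cube (k + 1))
       = \<one>\<^bsub>Z\<^esub>}"

text \<open>\<open>Z\<close>, acting through \<open>a\<close> on the \<open>i\<close>-th factor, is the \<open>i\<close>-th structure group: the action is
  free, its orbits are the fibres over the \<open>(i-1)\<close>-th factor, and two cubes of the \<open>i\<close>-th factor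
  with the same projection differ exactly by a cube of \<open>\<D>\<^sub>i(Z)\<close>. The last condition makes the
  group law the one induced by the cubes; free transitivity on the fibres alone would only
  determine the cardinality of \<open>Z\<close>.\<close>

definition structure_group ::
    "'a cubespace \<Rightarrow> nat \<Rightarrow> ('g, 'm) monoid_scheme \<Rightarrow> ('g \<Rightarrow> 'a set \<Rightarrow> 'a set) \<Rightarrow> bool" where
  "structure_group X i Z a \<longleftrightarrow>
     comm_group Z \<and> group_action Z (points (factor X i)) a \<and>
     (\<forall>z\<in>carrier Z. \<forall>x\<in>points (factor X i). a z x = x \<longrightarrow> z = \<one>\<^bsub>Z\<^esub>) \<and>
     (\<forall>x\<in>points (factor X i). orbit Z a x =
        {y \<in> points (factor X i). factor_proj X (i - 1) y = factor_proj X (i - 1) x}) \<and>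
     (\<forall>n. \<forall>c\<in>cubes (factor X i) n.
        {c' \<in> cubes (factor X i) n.
           \<forall>v\<in>cube n. factor_proj X (i - 1) (c' v) = factor_proj X (i - 1) (c v)}
        = {(\<lambda>v\<in>cube n. a (d v) (c v)) | d. d \<in> degree_cubes Z i n})"

section \<open>Lie groups\<close>

text \<open>\<open>cont_diff d r U f\<close>: the function \<open>f\<close> is \<open>r\<close> times continuously differentiable on the open
  subset \<open>U\<close> of \<open>\<real>\<^sup>d\<close>, where \<open>\<real>\<^sup>d\<close> is rendered as \<open>Euclidean_space d\<close> because the dimension has
  to be existentially quantified.\<close>

fun cont_diff ::
    "nat \<Rightarrow> nat \<Rightarrow> (nat \<Rightarrow> real) set \<Rightarrow> ((nat \<Rightarrow> real) \<Rightarrow> real) \<Rightarrow> bool" where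
  "cont_diff d 0 U f =
     continuous_map (subtopology (Euclidean_space d) U) euclideanreal f"
| "cont_diff d (Suc r) U f =
     (continuous_map (subtopology (Euclidean_space d) U) euclideanreal f \<and>
      (\<forall>i<d. \<exists>g. (\<forall>x\<in>U. ((\<lambda>t. f (x(i := t))) has_real_derivative g x) (at (x i))) \<and>
                  cont_diff d r U g))"

definition smooth_map ::
    "nat \<Rightarrow> nat \<Rightarrow> (nat \<Rightarrow> real) set \<Rightarrow> ((nat \<Rightarrow> real) \<Rightarrow> nat \<Rightarrow> real) \<Rightarrow> bool" where
  "smooth_map d m U F \<longleftrightarrow> (\<forall>j<m. \<forall>r. cont_diff d r U (\<lambda>x. F x j))"

definition chart ::
    "'g topology \<Rightarrow> nat \<Rightarrow> 'g set \<Rightarrow> ('g \<Rightarrow> nat \<Rightarrow> real) \<Rightarrow> bool" where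
  "chart T d U p \<longleftrightarrow> openin T U \<and> openin (Euclidean_space d) (p ` U) \<and>
     homeomorphic_map (subtopology T U) (subtopology (Euclidean_space d) (p ` U)) p"

definition smooth_atlas ::
    "'g topology \<Rightarrow> nat \<Rightarrow> ('g set \<times> ('g \<Rightarrow> nat \<Rightarrow> real)) set \<Rightarrow> bool" where
  "smooth_atlas T d A \<longleftrightarrow>
     (\<forall>(U, p)\<in>A. chart T d U p) \<and> (\<Union>(U, p)\<in>A. U) = topspace T \<and>
     (\<forall>(U, p)\<in>A. \<forall>(V, q)\<in>A. smooth_map d d (p ` (U \<inter> V)) (\<lambda>x. q (inv_into U p x)))"

text \<open>The two components of a point of \<open>\<real>\<^sup>d \<times> \<real>\<^sup>d = \<real>\<^sup>d\<^sup>+\<^sup>d\<close>.\<close>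

definition left_part :: "nat \<Rightarrow> (nat \<Rightarrow> real) \<Rightarrow> nat \<Rightarrow> real" where
  "left_part d x = (\<lambda>i. if i < d then x i else 0)"

definition right_part :: "nat \<Rightarrow> (nat \<Rightarrow> real) \<Rightarrow> nat \<Rightarrow> real" where
  "right_part d x = (\<lambda>i. if i < d then x (d + i) else 0)"

definition topological_group :: "('g, 'm) monoid_scheme \<Rightarrow> 'g topology \<Rightarrow> bool" where
  "topological_group G T \<longleftrightarrow> group G \<and> topspace T = carrier G \<and>
     continuous_map (prod_topology T T) T (\<lambda>(x, y). x \<otimes>\<^bsub>G\<^esub> y) \<and>
     continuous_map T T (\<lambda>x. inv\<^bsub>G\<^esub> x)"

definition lie_group :: "('g, 'm) monoid_scheme \<Rightarrow> 'g topology \<Rightarrow> bool" where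
  "lie_group G T \<longleftrightarrow> topological_group G T \<and> Hausdorff_space T \<and> second_countable T \<and>
     (\<exists>d A. smooth_atlas T d A \<and>
        (\<forall>(U, p)\<in>A. \<forall>(V, q)\<in>A. \<forall>(W, r)\<in>A.
           smooth_map (d + d) d
             {x \<in> topspace (Euclidean_space (d + d)).
                left_part d x \<in> p ` U \<and> right_part d x \<in> q ` V \<and>
                inv_into U p (left_part d x) \<otimes>\<^bsub>G\<^esub> inv_into V q (right_part d x) \<in> W}
             (\<lambda>x. r (inv_into U p (left_part d x) \<otimes>\<^bsub>G\<^esub> inv_into V q (right_part d x)))) \<and>
        (\<forall>(U, p)\<in>A. \<forall>(V, q)\<in>A.
           smooth_map d d {x \<in> p ` U. inv\<^bsub>G\<^esub> (inv_into U p x) \<in> V}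
             (\<lambda>x. q (inv\<^bsub>G\<^esub> (inv_into U p x)))))"

definition compactly_generated :: "('g, 'm) monoid_scheme \<Rightarrow> 'g topology \<Rightarrow> bool" where
  "compactly_generated G T \<longleftrightarrow> (\<exists>K. compactin T K \<and> generate G K = carrier G)"

section \<open>Topological nilspaces\<close>

definition lch_nilspace :: "'a cubespace \<Rightarrow> 'a topology \<Rightarrow> bool" where
  "lch_nilspace X T \<longleftrightarrow> nilspace X \<and> topspace T = points X \<and>
     locally_compact_space T \<and> Hausdorff_space T \<and> second_countable T \<and>
     (\<forall>n. closedin (product_topology (\<lambda>_. T) (cube n)) (cubes X n)) \<and>
     (\<forall>n\<ge>1. open_map
        (subtopology (product_topology (\<lambda>_. T) (cube n)) (cubes X n))
        (subtopology (product_topology (\<lambda>_. T) (cube n - {one_vertex n})) (corners X n))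
        (\<lambda>c. restrict c (cube n - {one_vertex n})))"

text \<open>A structure group is determined up to isomorphism and is equipotent to any fibre, so it may
  be taken with elements in the type of the points of the factor. Its topology is that of the fibre
  through a point \<open>x\<close>, transported along the bijection \<open>z \<mapsto> a z x\<close> of \<open>Z\<close> onto that fibre.\<close>

definition lie_fibered :: "nat \<Rightarrow> 'a cubespace \<Rightarrow> 'a topology \<Rightarrow> bool" where
  "lie_fibered k X T \<longleftrightarrow> step_nilspace k X \<and> lch_nilspace X T \<and>
     (\<forall>i\<in>{1..k}. \<exists>(Z :: 'a set monoid) a. structure_group X i Z a \<and>
        (\<exists>x\<in>points (factor X i).
           let TZ = pullback_topology (carrier Z) (\<lambda>z. a z x) (factor_topology X T i)
           in lie_group Z TZ \<and> compactly_generated Z TZ))"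

end

theory Submission
  imports Defs
begin

text \<open>Write \<open>R m a b\<close> if the map on the \<open>m\<close>-cube with value \<open>b\<close> at \<open>1\<^sup>m\<close> and \<open>a\<close> elsewhere is a cube;
  this is the equivalence relation defining the factor of order \<open>m - 1\<close>. By induction on
  \<open>m \<ge> 1\<close>, every point near \<open>\<phi> x\<close> is \<open>R m\<close>-related to \<open>\<phi> x'\<close> for some \<open>x'\<close> near \<open>x\<close>; the case
  \<open>m = 1\<close> is trivial, and for \<open>m = k + 1\<close> the relation is equality on \<open>Y\<close>.

  The induction step is the open mapping theorem for structure groups, phrased without the groups.
  Let \<open>G\<close> and \<open>F\<close> be the \<open>R m\<close>-classes of \<open>x\<close> and \<open>\<phi> x\<close>. Since \<open>\<phi>\<close> is a fibration, it maps
  \<open>G\<close> onto \<open>F\<close>, so by the Baire category theorem the image of some small piece \<open>V\<close> of \<open>G\<close>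
  contains a neighbourhood in \<open>F\<close> of some \<open>\<phi> a\<close> with \<open>a \<in> V\<close>. For \<open>y\<close> near \<open>\<phi> x\<close> take \<open>x0\<close>
  near \<open>x\<close> with \<open>R m (\<phi> x0) y\<close>, transport the small difference \<open>y - \<phi> x0\<close> to \<open>\<phi> a\<close> by completing
  a corner, lift the result to \<open>b \<in> V\<close>, and transport the difference \<open>b - a\<close> back to \<open>x0\<close>. This
  yields \<open>x'\<close> with \<open>R (m + 1) (\<phi> x') y\<close>, and \<open>x'\<close> is near \<open>x\<close> because \<open>a\<close> and \<open>b\<close> both lie in
  the small set \<open>V\<close>.\<close>

section \<open>Morphisms of discrete cubes and their lower faces\<close>

lemma cube_morphism_comp:
  assumes "cube_morphism m n g" "cube_morphism l m h"
  shows "cube_morphism l n (\<lambda>v. g (h v))"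
proof -
  have h: "\<And>v. v \<in> cube l \<Longrightarrow> h v \<in> cube m" and g: "\<And>v. v \<in> cube m \<Longrightarrow> g v \<in> cube n"
    using assms by (auto simp: cube_morphism_def)
  have "(\<exists>b. \<forall>v\<in>cube l. g (h v) ! j = b) \<or>
            (\<exists>i<l. \<forall>v\<in>cube l. g (h v) ! j = v ! i) \<or>
            (\<exists>i<l. \<forall>v\<in>cube l. g (h v) ! j = (\<not> v ! i))" if j: "j < n" for j
  proof -
    have H: "(\<exists>b. \<forall>v\<in>cube l. h v ! i = b) \<or> (\<exists>i'<l. \<forall>v\<in>cube l. h v ! i = v ! i') \<or>
        (\<exists>i'<l. \<forall>v\<in>cube l. h v ! i = (\<not> v ! i'))" if "i < m" for i
      using assms(2) that by (auto simp: cube_morphism_def)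
    consider b where "\<forall>v\<in>cube m. g v ! j = b" | i where "i < m" "\<forall>v\<in>cube m. g v ! j = v ! i"
      | i where "i < m" "\<forall>v\<in>cube m. g v ! j = (\<not> v ! i)"
      using assms(1) j unfolding cube_morphism_def by blast
    then show ?thesis
    proof cases
      case 1 then show ?thesis using h by blast
    next
      case (2 i)
      then have *: "\<forall>v\<in>cube l. g (h v) ! j = h v ! i" using h by blast
      show ?thesis using H[OF 2(1)] * by simp
    next
      case (3 i)
      then have *: "\<forall>v\<in>cube l. g (h v) ! j = (\<not> h v ! i)" using h by blast
      consider b where "\<forall>v\<in>cube l. h v ! i = b" | i' where "i' < l" "\<forall>v\<in>cube l. h v ! i = v ! i'"
        | i' where "i' < l" "\<forall>v\<in>cube l. h v ! i = (\<not> v ! i')"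
        using H[OF 3(1)] by blast
      then show ?thesis
      proof cases
        case 1
        then have "\<forall>v\<in>cube l. g (h v) ! j = (\<not> b)" using * by simp
        then show ?thesis by blast
      next
        case 2
        then have "\<forall>v\<in>cube l. g (h v) ! j = (\<not> v ! i')" using * by simp
        then show ?thesis using 2(1) by blast
      next
        case 3
        then have "\<forall>v\<in>cube l. g (h v) ! j = v ! i'" using * by simp
        then show ?thesis using 3(1) by blast
      qed
    qed
  qed
  moreover have "\<forall>v\<in>cube l. g (h v) \<in> cube n" using h g by blast
  ultimately show ?thesis unfolding cube_morphism_def by blast
qed

lemma cube_morphismI:
  assumes "\<And>v. v \<in> cube m \<Longrightarrow> length (g v) = n"
    and "\<And>j. j < n \<Longrightarrow> (\<exists>b. \<forall>v\<in>cube m. g v ! j = b) \<or>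
      (\<exists>i<m. \<forall>v\<in>cube m. g v ! j = v ! i) \<or> (\<exists>i<m. \<forall>v\<in>cube m. g v ! j = (\<not> v ! i))"
  shows "cube_morphism m n g"
  using assms by (simp add: cube_morphism_def cube_def)

lemma length_zero_face: "w \<in> cube (n - 1) \<Longrightarrow> i < n \<Longrightarrow> length (zero_face i w) = n"
  by (auto simp: zero_face_def cube_def)

lemma nth_zero_face:
  assumes "w \<in> cube (n - 1)" "i < n" "j < n"
  shows "zero_face i w ! j = (if j < i then w ! j else if j = i then False else w ! (j - 1))"
  using assms by (auto simp: zero_face_def cube_def nth_append nth_Cons')

lemma zero_face_neq_one:
  assumes "w \<in> cube (n - 1)" "i < n"
  shows "zero_face i w \<noteq> one_vertex n"
  using nth_zero_face[OF assms assms(2)] assms by auto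

lemma cube_morphism_zero_face:
  assumes "i < n"
  shows "cube_morphism (n - 1) n (zero_face i)"
proof (rule cube_morphismI)
  fix j assume j: "j < n"
  consider "j < i" | "j = i" | "j > i" by linarith
  then show "(\<exists>b. \<forall>v\<in>cube (n - 1). zero_face i v ! j = b) \<or>
      (\<exists>i'<n - 1. \<forall>v\<in>cube (n - 1). zero_face i v ! j = v ! i') \<or>
      (\<exists>i'<n - 1. \<forall>v\<in>cube (n - 1). zero_face i v ! j = (\<not> v ! i'))"
  proof cases
    case 1
    then have "j < n - 1" "\<forall>v\<in>cube (n - 1). zero_face i v ! j = v ! j"
      using nth_zero_face[OF _ assms j] assms by auto
    then show ?thesis by blast
  next
    case 2
    then have "\<forall>v\<in>cube (n - 1). zero_face i v ! j = False"
      using nth_zero_face[OF _ assms j] by auto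
    then show ?thesis by blast
  next
    case 3
    then have "j - 1 < n - 1" "\<forall>v\<in>cube (n - 1). zero_face i v ! j = v ! (j - 1)"
      using nth_zero_face[OF _ assms j] j by auto
    then show ?thesis by blast
  qed
qed (use length_zero_face assms in auto)

lemma one_vertex_in_cube [simp]: "one_vertex n \<in> cube n"
  by (simp add: cube_def)

lemma cubes_extensional: "nilspace X \<Longrightarrow> c \<in> cubes X n \<Longrightarrow> c \<in> cube n \<rightarrow>\<^sub>E points X"
  unfolding nilspace_def by blast

lemma cube_value_in_points: "nilspace X \<Longrightarrow> c \<in> cubes X n \<Longrightarrow> v \<in> cube n \<Longrightarrow> c v \<in> points X"
  using cubes_extensional by blast

lemma cubes_comp:
  assumes "nilspace X" "c \<in> cubes X n" "cube_morphism m n g"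
  shows "(\<lambda>v\<in>cube m. c (g v)) \<in> cubes X m"
proof -
  have *: "\<forall>m n g. \<forall>c\<in>cubes X n. cube_morphism m n g \<longrightarrow> (\<lambda>v\<in>cube m. c (g v)) \<in> cubes X m"
    using assms(1) unfolding nilspace_def by (elim conjE)
  show ?thesis by (rule *[rule_format, OF assms(2,3)])
qed

lemma cubes_comp_cong:
  assumes "nilspace X" "c \<in> cubes X n" "cube_morphism m n g" "\<And>v. v \<in> cube m \<Longrightarrow> f v = c (g v)"
  shows "(\<lambda>v\<in>cube m. f v) \<in> cubes X m"
proof -
  have "(\<lambda>v\<in>cube m. f v) = (\<lambda>v\<in>cube m. c (g v))"
    using assms(4) by (rule restrict_ext)
  then show ?thesis using cubes_comp[OF assms(1-3)] by simp
qed

lemma corner_completion: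
  "nilspace X \<Longrightarrow> 1 \<le> n \<Longrightarrow> l \<in> corners X n \<Longrightarrow>
    \<exists>c\<in>cubes X n. \<forall>v\<in>cube n - {one_vertex n}. c v = l v"
  unfolding nilspace_def by blast

section \<open>Extension from simplicial sets\<close>

definition vmeet :: "bool list \<Rightarrow> bool list \<Rightarrow> bool list" where
  "vmeet v w = map2 (\<and>) v w"

lemma length_vmeet [simp]: "length v = n \<Longrightarrow> length w = n \<Longrightarrow> length (vmeet v w) = n"
  by (simp add: vmeet_def)

lemma nth_vmeet: "length v = n \<Longrightarrow> length w = n \<Longrightarrow> j < n \<Longrightarrow> vmeet v w ! j = (v ! j \<and> w ! j)"
  by (simp add: vmeet_def)

lemma vmeet_in_cube: "v \<in> cube n \<Longrightarrow> w \<in> cube n \<Longrightarrow> vmeet v w \<in> cube n"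
  by (simp add: cube_def)

text \<open>The cube condition on the face of all vertices below \<open>v\<close>, pulled back to the whole
  \<open>n\<close>-cube along the retraction \<open>w \<mapsto> vmeet w v\<close>.\<close>

definition cube_below :: "'a cubespace \<Rightarrow> nat \<Rightarrow> (bool list \<Rightarrow> 'a) \<Rightarrow> bool list \<Rightarrow> bool" where
  "cube_below X n f v \<longleftrightarrow> (\<lambda>w\<in>cube n. f (vmeet w v)) \<in> cubes X n"

text \<open>The vertices below \<open>v\<close> form a face with top vertex \<open>v\<close>. The
  hypothesis on the lower vertices makes the remaining values a corner on that face, and any
  completion supplies the value at \<open>v\<close>.\<close>

lemma cube_below_extend_one:
  assumes X: "nilspace X" and v: "v \<in> cube N" "v \<noteq> zero_vertex N"
    and below: "\<And>w. w \<in> cube N \<Longrightarrow> vmeet w v \<noteq> v \<Longrightarrow> cube_below X N f (vmeet w v)"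
  shows "\<exists>a. cube_below X N (f(v := a)) v"
proof -
  \<comment> \<open>\<open>ix\<close> lists the coordinates at which \<open>v\<close> is true.
    Below, \<open>emb\<close> identifies the \<open>n\<close>-cube with the face below
    \<open>v\<close>, and \<open>ret\<close> forgets the other coordinates, so that
    \<open>emb (ret w) = vmeet w v\<close>.\<close>
  define ix where "ix = filter (\<lambda>j. v ! j) [0..<N]"
  define n where "n = length ix"
  have set_ix: "set ix = {j. j < N \<and> v ! j}" by (auto simp: ix_def)
  have lenv: "length v = N" using v by (simp add: cube_def)
  have ixn: "ix ! i < N" "v ! (ix ! i)" if "i < n" for i
    using set_ix nth_mem[of i ix] that by (auto simp: n_def)
  have dist: "distinct ix" by (simp add: ix_def)
  have "\<forall>j. \<exists>i. j \<in> set ix \<longrightarrow> i < n \<and> ix ! i = j"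
    unfolding in_set_conv_nth n_def by blast
  then obtain pos where pos: "\<And>j. j \<in> set ix \<Longrightarrow> pos j < n \<and> ix ! pos j = j"
    by metis
  have pos_ix: "pos (ix ! i) = i" if "i < n" for i
    using pos[of "ix ! i"] that dist nth_mem[of i ix] nth_eq_iff_index_eq[OF dist]
    unfolding n_def by blast
  define emb where "emb z = map (\<lambda>j. if v ! j then z ! pos j else False) [0..<N]" for z :: "bool list"
  define ret where "ret w = map (\<lambda>j. w ! j) ix" for w :: "bool list"
  have emb_nth: "emb z ! j = (v ! j \<and> z ! pos j)" if "j < N" for z j
    using that by (simp add: emb_def)
  have emb_cube: "emb z \<in> cube N" for z by (simp add: emb_def cube_def)
  have emb: "cube_morphism n N emb"
  proof (rule cube_morphismI)
    fix j assume j: "j < N"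
    show "(\<exists>b. \<forall>z\<in>cube n. emb z ! j = b) \<or> (\<exists>i<n. \<forall>z\<in>cube n. emb z ! j = z ! i) \<or>
        (\<exists>i<n. \<forall>z\<in>cube n. emb z ! j = (\<not> z ! i))"
    proof (cases "v ! j")
      case True
      then have "pos j < n" using pos j set_ix by auto
      then show ?thesis using emb_nth[OF j] True by auto
    qed (use emb_nth[OF j] in auto)
  qed (simp add: emb_def)
  have ret: "cube_morphism N n ret"
    using ixn by (intro cube_morphismI) (auto simp: ret_def n_def)
  have ret_cube: "ret w \<in> cube n" for w by (simp add: ret_def cube_def n_def)
  have emb_meet: "vmeet (emb z) v = emb z" for z
    using lenv emb_cube[of z] emb_nth by (auto intro!: nth_equalityI simp: cube_def nth_vmeet)
  have emb_neq: "emb z \<noteq> v" if z: "z \<in> cube n" "z \<noteq> one_vertex n" for z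
  proof
    assume e: "emb z = v"
    have "z ! i" if "i < n" for i
      using emb_nth[OF ixn(1)[OF that], of z] ixn(2)[OF that] pos_ix[OF that] e by simp
    then have "z = one_vertex n" using z by (auto intro!: nth_equalityI simp: cube_def)
    then show False using z by simp
  qed
  have emb_ret: "emb (ret w) = vmeet w v" if "w \<in> cube N" for w
  proof (rule nth_equalityI)
    fix j assume "j < length (emb (ret w))"
    then have j: "j < N" by (simp add: emb_def)
    show "emb (ret w) ! j = vmeet w v ! j"
    proof (cases "v ! j")
      case True
      then have "pos j < n" "ix ! pos j = j" using pos j set_ix by auto
      then have "ret w ! pos j = w ! j" by (simp add: ret_def n_def)
      then show ?thesis using emb_nth[OF j] True that lenv j by (simp add: nth_vmeet cube_def)
    next
      case False
      then show ?thesis using emb_nth[OF j] that lenv j by (simp add: nth_vmeet cube_def)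
    qed
  qed (use that lenv in \<open>simp add: emb_def cube_def\<close>)
  have n1: "1 \<le> n"
  proof (rule ccontr)
    assume "\<not> 1 \<le> n"
    then have "ix = []" unfolding n_def by (cases ix) auto
    then have "\<not> v ! j" if "j < N" for j using set_ix that by auto
    then have "v = zero_vertex N" using lenv by (auto intro!: nth_equalityI)
    then show False using v by simp
  qed
  define l where "l = (\<lambda>z\<in>cube n - {one_vertex n}. f (emb z))"
  have "l \<in> corners X n"
  proof -
    have "f (emb z) \<in> points X" if z: "z \<in> cube n" "z \<noteq> one_vertex n" for z
    proof -
      have "cube_below X N f (emb z)"
        using below[of "emb z"] emb_neq[OF z] emb_meet emb_cube by simp
      then have "(\<lambda>w\<in>cube N. f (vmeet w (emb z))) (emb z) \<in> points X"
        unfolding cube_below_def using cube_value_in_points[OF X _ emb_cube] by blast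
      moreover have "vmeet (emb z) (emb z) = emb z"
        using emb_cube[of z] by (auto intro!: nth_equalityI simp: cube_def nth_vmeet)
      ultimately show ?thesis using emb_cube by simp
    qed
    moreover have "(\<lambda>w\<in>cube (n - 1). l (zero_face i w)) \<in> cubes X (n - 1)" if i: "i < n" for i
    proof -
      \<comment> \<open>The face of the corner where coordinate \<open>i\<close> vanishes is mapped
        by \<open>emb\<close> below \<open>u\<close>, which is \<open>v\<close> with the matching
        coordinate cleared; hence \<open>cube_below\<close> at \<open>u\<close> settles this
        face.\<close>
      define u where "u = v[ix ! i := False]"
      have u: "u \<in> cube N" using lenv by (simp add: u_def cube_def)
      have mu: "vmeet u v = u"
        using u lenv ixn(1)[OF i]
        by (auto intro!: nth_equalityI simp: cube_def nth_vmeet u_def nth_list_update)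
      have "u ! (ix ! i) \<noteq> v ! (ix ! i)" using ixn[OF i] lenv by (simp add: u_def)
      then have "u \<noteq> v" by auto
      then have "cube_below X N f u" using below[OF u] mu by simp
      moreover have "cube_morphism (n - 1) N (\<lambda>w. emb (zero_face i w))"
        by (rule cube_morphism_comp[OF emb cube_morphism_zero_face[OF i]])
      moreover have "l (zero_face i w) = (\<lambda>w\<in>cube N. f (vmeet w u)) (emb (zero_face i w))"
        if w: "w \<in> cube (n - 1)" for w
      proof -
        have zf: "zero_face i w \<in> cube n" using length_zero_face[OF w i] by (simp add: cube_def)
        have "\<not> zero_face i w ! i" using nth_zero_face[OF w i i] by simp
        then have "\<not> emb (zero_face i w) ! (ix ! i)"
          using emb_nth[OF ixn(1)[OF i]] pos_ix[OF i] by simp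
        then have "vmeet (emb (zero_face i w)) u = emb (zero_face i w)"
          using emb_cube[of "zero_face i w"] u lenv emb_nth ixn(1)[OF i]
          by (auto intro!: nth_equalityI simp: cube_def nth_vmeet u_def nth_list_update)
        then show ?thesis using zf zero_face_neq_one[OF w i] emb_cube by (simp add: l_def)
      qed
      ultimately show ?thesis
        unfolding cube_below_def by (intro cubes_comp_cong[OF X])
    qed
    ultimately show ?thesis by (auto simp: corners_def l_def)
  qed
  then obtain c where c: "c \<in> cubes X n" "\<And>z. z \<in> cube n - {one_vertex n} \<Longrightarrow> c z = l z"
    using corner_completion[OF X n1] by blast
  have "(\<lambda>w\<in>cube N. (f(v := c (one_vertex n))) (vmeet w v)) \<in> cubes X N"
  proof (rule cubes_comp_cong[OF X c(1) ret])
    fix w assume w: "w \<in> cube N"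
    show "(f(v := c (one_vertex n))) (vmeet w v) = c (ret w)"
    proof (cases "ret w = one_vertex n")
      case True
      have "emb (one_vertex n) = v"
        using lenv pos set_ix by (auto intro!: nth_equalityI simp: emb_def)
      then show ?thesis using True emb_ret[OF w] by simp
    next
      case False
      then have "c (ret w) = f (emb (ret w))" "emb (ret w) \<noteq> v"
        using c(2)[of "ret w"] emb_neq ret_cube by (auto simp: l_def)
      then show ?thesis using emb_ret[OF w] by simp
    qed
  qed
  then show ?thesis unfolding cube_below_def by blast
qed

lemma finite_cube: "finite (cube n)"
  using finite_lists_length_eq[of "UNIV :: bool set" n] by (simp add: cube_def)

lemma vmeet_one: "v \<in> cube n \<Longrightarrow> vmeet v (one_vertex n) = v"
  by (auto intro!: nth_equalityI simp: cube_def nth_vmeet)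

text \<open>Missing vertices are added one at a time. One with fewest true coordinates has all its
  proper predecessors in \<open>S\<close>, so its value comes from a corner, and adding it keeps the
  set closed downwards.\<close>

lemma simplicial_extension:
  assumes X: "nilspace X" and S: "S \<subseteq> cube N" "zero_vertex N \<in> S"
    and down: "\<And>v w. v \<in> S \<Longrightarrow> w \<in> cube N \<Longrightarrow> vmeet w v \<in> S"
    and f: "\<And>v. v \<in> S \<Longrightarrow> cube_below X N f v"
  shows "\<exists>c\<in>cubes X N. \<forall>v\<in>S. c v = f v"
  using S down f
proof (induction "card (cube N - S)" arbitrary: S f rule: less_induct)
  case less
  show ?case
  proof (cases "S = cube N")
    case True
    then have "cube_below X N f (one_vertex N)" using less.prems by simp
    then have "(\<lambda>w\<in>cube N. f (vmeet w (one_vertex N))) \<in> cubes X N"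
      by (simp add: cube_below_def)
    moreover have "\<forall>v\<in>S. (\<lambda>w\<in>cube N. f (vmeet w (one_vertex N))) v = f v"
      using True by (simp add: vmeet_one)
    ultimately show ?thesis by blast
  next
    case False
    let ?wt = "\<lambda>v :: bool list. card {j. j < N \<and> v ! j}"
    obtain v where v: "v \<in> cube N - S" and min: "\<And>w. w \<in> cube N - S \<Longrightarrow> ?wt v \<le> ?wt w"
      using False less.prems(1) ex_has_least_nat[of "\<lambda>v. v \<in> cube N - S" _ ?wt] by blast
    have lower: "vmeet w v \<in> S" if w: "w \<in> cube N" "vmeet w v \<noteq> v" for w
    proof (rule ccontr)
      assume "vmeet w v \<notin> S"
      then have le: "?wt v \<le> ?wt (vmeet w v)" using min w v vmeet_in_cube by blast
      have lens: "length w = N" "length v = N" using w v by (auto simp: cube_def)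
      then have sub: "{j. j < N \<and> vmeet w v ! j} \<subseteq> {j. j < N \<and> v ! j}"
        by (auto simp: nth_vmeet)
      have "{j. j < N \<and> vmeet w v ! j} = {j. j < N \<and> v ! j}"
        by (rule card_seteq[OF _ sub le]) simp
      then have "vmeet w v ! j = v ! j" if "j < N" for j using that by blast
      then have "vmeet w v = v" using lens by (intro nth_equalityI) simp_all
      then show False using w by simp
    qed
    have "v \<noteq> zero_vertex N" using v less.prems(2) by auto
    then obtain a where a: "cube_below X N (f(v := a)) v"
      using cube_below_extend_one[OF X, of v N f] v lower less.prems(4) by blast
    have "\<exists>c\<in>cubes X N. \<forall>u\<in>insert v S. c u = (f(v := a)) u"
    proof (rule less.hyps)
      have "cube N - insert v S \<subset> cube N - S" using v by blast
      then show "card (cube N - insert v S) < card (cube N - S)"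
        by (intro psubset_card_mono) (use finite_cube in auto)
      show "insert v S \<subseteq> cube N" using v less.prems(1) by blast
      show "zero_vertex N \<in> insert v S" using less.prems(2) by blast
      show "vmeet w u \<in> insert v S" if "u \<in> insert v S" "w \<in> cube N" for u w
        using that less.prems(3) lower by blast
      show "cube_below X N (f(v := a)) u" if "u \<in> insert v S" for u
      proof (cases "u = v")
        case False
        then have u: "u \<in> S" using that by simp
        have "(\<lambda>w\<in>cube N. (f(v := a)) (vmeet w u)) = (\<lambda>w\<in>cube N. f (vmeet w u))"
          using less.prems(3)[OF u] v by (intro restrict_ext) auto
        then show ?thesis using less.prems(4)[OF u] by (simp add: cube_below_def)
      qed (use a in simp)
    qed
    then obtain c where c: "c \<in> cubes X N" "\<forall>u\<in>insert v S. c u = (f(v := a)) u" by blast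
    have "c u = f u" if "u \<in> S" for u using that v c(2) by auto
    then show ?thesis using c(1) by blast
  qed
qed

section \<open>The relations of the factors\<close>

text \<open>\<open>spike m a b\<close> is an \<open>m\<close>-cube exactly when \<open>a\<close> and \<open>b\<close> have the same image in the factor of
  order \<open>m - 1\<close>.\<close>

definition spike :: "nat \<Rightarrow> 'a \<Rightarrow> 'a \<Rightarrow> bool list \<Rightarrow> 'a" where
  "spike m a b = (\<lambda>v\<in>cube m. if v = one_vertex m then b else a)"

text \<open>For positive \<open>m\<close>, the assumption is, up to reflecting the cube, the
  defining condition of the factor relation of order \<open>m - 1\<close>; it is reduced here to a
  single cube that is constant off one vertex.\<close>

lemma spike_of_agreeing_cubes:
  assumes X: "nilspace X" and c: "c \<in> cubes X m" and c': "c' \<in> cubes X m"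
    and agree: "\<And>v. v \<in> cube m - {one_vertex m} \<Longrightarrow> c v = c' v"
  shows "spike m (c (one_vertex m)) (c' (one_vertex m)) \<in> cubes X m"
proof (cases "m = 0")
  case True
  then have "spike m (c (one_vertex m)) (c' (one_vertex m)) = c'"
    using cubes_extensional[OF X c'] by (auto simp: spike_def cube_def PiE_def extensional_def)
  then show ?thesis using c' by simp
next
  case False
  txt \<open>A vertex \<open>(u, w)\<close> of the \<open>2m\<close>-cube with \<open>u\<close>, \<open>w\<close> disjoint encodes a vertex of the grid
    \<open>{0, 1, 2}\<^sup>m\<close>: a coordinate is the middle value \<open>1\<close> if it is \<open>0\<close> in both, and an outer value
    otherwise. On the grid, \<open>c\<close> is folded around the middle vertex and then altered at one extreme
    vertex; all \<open>2\<^sup>m\<close> small subcubes are copies of \<open>c\<close>, except one that is a copy of \<open>c'\<close>.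
    After extension to the \<open>2m\<close>-cube, the antidiagonal \<open>v \<mapsto> (1 - v, v)\<close> reads off the outer
    vertices of the grid, which form the spike.\<close>
  let ?N = "m + m"
  define f where "f z = (if drop m z = one_vertex m then c' (one_vertex m)
      else c (map2 (\<or>) (take m z) (drop m z)))" for z
  define S where "S = {z \<in> cube ?N. \<forall>j<m. \<not> (z ! j \<and> z ! (m + j))}"
  have "\<exists>e\<in>cubes X ?N. \<forall>v\<in>S. e v = f v"
  proof (rule simplicial_extension[OF X])
    show "S \<subseteq> cube ?N" by (auto simp: S_def)
    show "zero_vertex ?N \<in> S" by (auto simp: S_def cube_def)
    show "vmeet w v \<in> S" if "v \<in> S" "w \<in> cube ?N" for v w
      using that by (auto simp: S_def vmeet_in_cube nth_vmeet cube_def)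
    show "cube_below X ?N f v" if v: "v \<in> S" for v
    proof -
      have vN: "length v = ?N" using v by (simp add: S_def cube_def)
      have dj: "\<not> (v ! j \<and> v ! (m + j))" if "j < m" for j using v that by (simp add: S_def)
      \<comment> \<open>For \<open>v\<close> in \<open>S\<close> at most one of the paired
        coordinates \<open>j\<close> and \<open>m + j\<close> of \<open>v\<close> is true. Folding
        after the meet with \<open>v\<close> thus reads a single coordinate or the constant
        \<open>False\<close>, which makes it a cube morphism.\<close>
      define g where "g z = map (\<lambda>j. if v ! j then z ! j else if v ! (m + j) then z ! (m + j) else False)
        [0..<m]" for z :: "bool list"
      have g: "cube_morphism ?N m g"
      proof (rule cube_morphismI)
        fix j assume j: "j < m"
        then have jN: "j < ?N" "m + j < ?N" by auto
        have gj: "\<forall>z\<in>cube ?N. g z ! j = (if v ! j then z ! j else if v ! (m + j) then z ! (m + j) else False)"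
          using j by (simp add: g_def)
        consider "v ! j" | "\<not> v ! j" "v ! (m + j)" | "\<not> v ! j" "\<not> v ! (m + j)" by blast
        then show "(\<exists>b. \<forall>z\<in>cube ?N. g z ! j = b) \<or> (\<exists>i<?N. \<forall>z\<in>cube ?N. g z ! j = z ! i) \<or>
            (\<exists>i<?N. \<forall>z\<in>cube ?N. g z ! j = (\<not> z ! i))"
        proof cases
          case 1
          then have "\<forall>z\<in>cube ?N. g z ! j = z ! j" using gj by simp
          then show ?thesis using jN by blast
        next
          case 2
          then have "\<forall>z\<in>cube ?N. g z ! j = z ! (m + j)" using gj by simp
          then show ?thesis using jN by blast
        next
          case 3
          then have "\<forall>z\<in>cube ?N. g z ! j = False" using gj by simp
          then show ?thesis by blast
        qed
      qed (simp add: g_def)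
      have gm: "map2 (\<or>) (take m (vmeet z v)) (drop m (vmeet z v)) = g z" if "z \<in> cube ?N" for z
      proof (rule nth_equalityI)
        fix j assume "j < length (map2 (\<or>) (take m (vmeet z v)) (drop m (vmeet z v)))"
        then have "j < m" using that vN by (simp add: cube_def)
        then show "map2 (\<or>) (take m (vmeet z v)) (drop m (vmeet z v)) ! j = g z ! j"
          using that vN dj[of j] by (auto simp: g_def cube_def nth_vmeet)
      qed (use that vN in \<open>simp add: g_def cube_def\<close>)
      show ?thesis
      proof (cases "drop m v = one_vertex m")
        case True
        \<comment> \<open>This face contains the altered vertex. The first half of \<open>v\<close>
          vanishes, so the second half of \<open>vmeet z v\<close> is already \<open>g z\<close>,
          and the altered value is the one that \<open>c'\<close> takes.\<close>
        have v2: "v ! (m + j)" if "j < m" for j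
          using that True vN nth_drop[of m v j] by simp
        have "(\<lambda>z\<in>cube ?N. f (vmeet z v)) \<in> cubes X ?N"
        proof (rule cubes_comp_cong[OF X c' g])
          fix z assume z: "z \<in> cube ?N"
          have "drop m (vmeet z v) = g z"
          proof (rule nth_equalityI)
            fix j assume "j < length (drop m (vmeet z v))"
            then have "j < m" using z vN by (simp add: cube_def)
            then show "drop m (vmeet z v) ! j = g z ! j"
              using z vN v2[of j] dj[of j] by (auto simp: g_def cube_def nth_vmeet)
          qed (use z vN in \<open>simp add: g_def cube_def\<close>)
          moreover have "g z \<in> cube m" by (simp add: g_def cube_def)
          ultimately show "f (vmeet z v) = c' (g z)"
            using gm[OF z] agree[of "g z"] by (auto simp: f_def)
        qed
        then show ?thesis by (simp add: cube_below_def)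
      next
        case False
        have "\<exists>j<m. \<not> v ! (m + j)"
        proof (rule ccontr)
          assume "\<not> ?thesis"
          then have "drop m v = one_vertex m" using vN by (intro nth_equalityI) simp_all
          with False show False by simp
        qed
        then obtain j where j: "j < m" "\<not> v ! (m + j)" by blast
        have "(\<lambda>z\<in>cube ?N. f (vmeet z v)) \<in> cubes X ?N"
        proof (rule cubes_comp_cong[OF X c g])
          fix z assume z: "z \<in> cube ?N"
          have "\<not> drop m (vmeet z v) ! j" using z vN j by (simp add: cube_def nth_vmeet)
          then have "drop m (vmeet z v) \<noteq> one_vertex m" using j by auto
          then show "f (vmeet z v) = c (g z)" using gm[OF z] by (simp add: f_def)
        qed
        then show ?thesis by (simp add: cube_below_def)
      qed
    qed
  qed
  then obtain e where e: "e \<in> cubes X ?N" "\<And>v. v \<in> S \<Longrightarrow> e v = f v" by blast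
  define h where "h v = map Not v @ v" for v
  have h: "cube_morphism m ?N h"
  proof (rule cube_morphismI)
    fix j assume j: "j < ?N"
    show "(\<exists>b. \<forall>v\<in>cube m. h v ! j = b) \<or> (\<exists>i<m. \<forall>v\<in>cube m. h v ! j = v ! i) \<or>
        (\<exists>i<m. \<forall>v\<in>cube m. h v ! j = (\<not> v ! i))"
    proof (cases "j < m")
      case True
      then have "\<forall>v\<in>cube m. h v ! j = (\<not> v ! j)" by (simp add: h_def cube_def nth_append)
      then show ?thesis using True by blast
    next
      case False
      then have "\<forall>v\<in>cube m. h v ! j = v ! (j - m)" "j - m < m"
        using j by (auto simp: h_def cube_def nth_append)
      then show ?thesis by blast
    qed
  qed (simp add: h_def cube_def)
  show ?thesis unfolding spike_def
  proof (rule cubes_comp_cong[OF X e(1) h])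
    fix v assume v: "v \<in> cube m"
    have "h v \<in> S" using v by (auto simp: S_def h_def cube_def nth_append)
    moreover have "map2 (\<or>) (map Not v) v = one_vertex m"
      using v by (auto intro!: nth_equalityI simp: cube_def)
    ultimately show "(if v = one_vertex m then c' (one_vertex m) else c (one_vertex m)) = e (h v)"
      using e(2) v by (simp add: f_def h_def cube_def)
  qed
qed

section \<open>Spikes as an equivalence relation, and pairs of spikes\<close>

lemma Cons_in_cube_Suc [simp]: "b # w \<in> cube (Suc m) \<longleftrightarrow> w \<in> cube m"
  by (simp add: cube_def)

text \<open>Two spikes with the same base agree off the top vertex. Together with
  \<open>spike_refl\<close> this yields symmetry and transitivity.\<close>

lemma spike_trans:
  assumes "nilspace X" "spike m a b \<in> cubes X m" "spike m a c \<in> cubes X m"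
  shows "spike m b c \<in> cubes X m"
proof -
  have "spike m (spike m a b (one_vertex m)) (spike m a c (one_vertex m)) \<in> cubes X m"
    by (rule spike_of_agreeing_cubes[OF assms]) (simp add: spike_def)
  then show ?thesis by (simp add: spike_def)
qed

lemma edge_cube:
  assumes X: "nilspace X" and "a \<in> points X" "b \<in> points X" "i < n"
  shows "(\<lambda>v\<in>cube n. if v ! i then b else a) \<in> cubes X n"
proof (rule cubes_comp_cong[OF X])
  have "cubes X 1 = (cube 1 \<rightarrow>\<^sub>E points X)" using X by (simp add: nilspace_def)
  then show "(\<lambda>w\<in>cube 1. if w ! 0 then b else a) \<in> cubes X 1" using assms by auto
  show "cube_morphism n 1 (\<lambda>v. [v ! i])"
    using assms by (intro cube_morphismI) auto
qed (simp add: cube_def)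

lemma const_cube:
  assumes X: "nilspace X" and "a \<in> points X"
  shows "(\<lambda>v\<in>cube n. a) \<in> cubes X n"
proof (rule cubes_comp_cong[OF X])
  show "(\<lambda>v\<in>cube 1. if v ! 0 then a else a) \<in> cubes X 1" by (rule edge_cube) (use assms in auto)
  show "cube_morphism n 1 (\<lambda>v. [False])"
    by (intro cube_morphismI) auto
qed (simp add: cube_def)

lemma spike_refl: "nilspace X \<Longrightarrow> a \<in> points X \<Longrightarrow> spike m a a \<in> cubes X m"
  using const_cube[of X a m] by (simp add: spike_def)

lemma spike_in_points: "nilspace X \<Longrightarrow> spike m a b \<in> cubes X m \<Longrightarrow> b \<in> points X"
  using cube_value_in_points[of X "spike m a b" m "one_vertex m"] by (simp add: spike_def)

lemma spike_one:
  "nilspace X \<Longrightarrow> a \<in> points X \<Longrightarrow> b \<in> points X \<Longrightarrow> spike 1 a b \<in> cubes X 1"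
  by (auto simp: nilspace_def spike_def)

lemma corner_of_cube:
  assumes X: "nilspace X" and c: "c \<in> cubes X n"
  shows "restrict c (cube n - {one_vertex n}) \<in> corners X n"
proof -
  have "(\<lambda>w\<in>cube (n - 1). restrict c (cube n - {one_vertex n}) (zero_face i w)) \<in> cubes X (n - 1)"
    if i: "i < n" for i
  proof (rule cubes_comp_cong[OF X c cube_morphism_zero_face[OF i]])
    fix w assume w: "w \<in> cube (n - 1)"
    then show "restrict c (cube n - {one_vertex n}) (zero_face i w) = c (zero_face i w)"
      using zero_face_neq_one[OF w i] length_zero_face[OF w i] by (simp add: cube_def)
  qed
  then show ?thesis using cube_value_in_points[OF X c] by (auto simp: corners_def)
qed

lemma nil_morphism_spike:
  assumes "nil_morphism X Y f" "spike m a b \<in> cubes X m"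
  shows "spike m (f a) (f b) \<in> cubes Y m"
proof -
  have "(\<lambda>v\<in>cube m. f (spike m a b v)) \<in> cubes Y m"
    using assms by (simp add: nil_morphism_def)
  moreover have "(\<lambda>v\<in>cube m. f (spike m a b v)) = spike m (f a) (f b)"
    by (auto simp: spike_def)
  ultimately show ?thesis by simp
qed

text \<open>The map on the \<open>(m + 1)\<close>-cube whose two faces in the first direction are \<open>spike m a b\<close>
  and \<open>spike m c d\<close>; if it is a cube, then \<open>a\<close> and \<open>b\<close> differ by the same element of the
  structure group as \<open>c\<close> and \<open>d\<close>.\<close>

definition spike_pair :: "nat \<Rightarrow> 'a \<Rightarrow> 'a \<Rightarrow> 'a \<Rightarrow> 'a \<Rightarrow> bool list \<Rightarrow> 'a" where
  "spike_pair m a b c d = (\<lambda>v\<in>cube (Suc m).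
     if v ! 0 then (if tl v = one_vertex m then d else c)
     else (if tl v = one_vertex m then b else a))"

lemma nil_morphism_spike_pair:
  assumes "nil_morphism X Y f" "spike_pair m a b c d \<in> cubes X (Suc m)"
  shows "spike_pair m (f a) (f b) (f c) (f d) \<in> cubes Y (Suc m)"
proof -
  have "(\<lambda>v\<in>cube (Suc m). f (spike_pair m a b c d v)) \<in> cubes Y (Suc m)"
    using assms by (simp add: nil_morphism_def)
  moreover have "(\<lambda>v\<in>cube (Suc m). f (spike_pair m a b c d v)) = spike_pair m (f a) (f b) (f c) (f d)"
    by (auto simp: spike_pair_def)
  ultimately show ?thesis by simp
qed

lemma spike_pair_top:
  assumes X: "nilspace X" and c: "spike_pair m a b c d \<in> cubes X (Suc m)"
  shows "spike m c d \<in> cubes X m"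
  unfolding spike_def
proof (rule cubes_comp_cong[OF X c])
  show "cube_morphism m (Suc m) (\<lambda>w. True # w)"
  proof (rule cube_morphismI)
    fix j assume "j < Suc m"
    then show "(\<exists>b. \<forall>v\<in>cube m. (True # v) ! j = b) \<or> (\<exists>i<m. \<forall>v\<in>cube m. (True # v) ! j = v ! i) \<or>
       (\<exists>i<m. \<forall>v\<in>cube m. (True # v) ! j = (\<not> v ! i))"
      by (cases j) auto
  qed (simp add: cube_def)
qed (simp add: spike_pair_def cube_def)

lemma spike_pair_swap:
  assumes X: "nilspace X" and c: "spike_pair m a b c d \<in> cubes X (Suc m)"
  shows "spike_pair m c d a b \<in> cubes X (Suc m)"
  unfolding spike_pair_def
proof (rule cubes_comp_cong[OF X c])
  show "cube_morphism (Suc m) (Suc m) (\<lambda>v. (\<not> v ! 0) # tl v)"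
  proof (rule cube_morphismI)
    fix j assume j: "j < Suc m"
    show "(\<exists>b. \<forall>v\<in>cube (Suc m). ((\<not> v ! 0) # tl v) ! j = b) \<or>
      (\<exists>i<Suc m. \<forall>v\<in>cube (Suc m). ((\<not> v ! 0) # tl v) ! j = v ! i) \<or>
      (\<exists>i<Suc m. \<forall>v\<in>cube (Suc m). ((\<not> v ! 0) # tl v) ! j = (\<not> v ! i))"
    proof (cases j)
      case (Suc i)
      then have "\<forall>v\<in>cube (Suc m). ((\<not> v ! 0) # tl v) ! j = v ! j"
        using j by (auto simp: cube_def nth_tl)
      then show ?thesis using j by blast
    qed auto
  qed (simp add: cube_def)
qed (simp add: spike_pair_def cube_def)

lemma one_vertex_Suc_iff: "v \<in> cube (Suc m) \<Longrightarrow> v = True # one_vertex m \<longleftrightarrow> v ! 0 \<and> tl v = one_vertex m"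
  by (cases v) (auto simp: cube_def)

text \<open>Both cubes complete the same corner, so the fourth point of a parallelogram is unique up
  to the next relation. This is what raises the order in the induction.\<close>

lemma spike_of_spike_pairs:
  assumes X: "nilspace X" and c: "spike_pair m a b c d \<in> cubes X (Suc m)"
    and c': "spike_pair m a b c d' \<in> cubes X (Suc m)"
  shows "spike (Suc m) d d' \<in> cubes X (Suc m)"
proof -
  have "spike (Suc m) (spike_pair m a b c d (one_vertex (Suc m)))
      (spike_pair m a b c d' (one_vertex (Suc m))) \<in> cubes X (Suc m)"
    by (rule spike_of_agreeing_cubes[OF assms]) (auto simp: spike_pair_def one_vertex_Suc_iff)
  then show ?thesis using one_vertex_in_cube[of "Suc m"] by (simp add: spike_pair_def)
qed

text \<open>The lower face in the first direction is the given spike; every other face through the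
  zero vertex avoids both tips and is an edge cube from \<open>a\<close> to \<open>c\<close>. The
  value \<open>d\<close> sits at the removed vertex.\<close>

lemma spike_pair_corner:
  assumes X: "nilspace X" and m: "1 \<le> m" and ab: "spike m a b \<in> cubes X m"
    and pts: "a \<in> points X" "c \<in> points X"
  shows "restrict (spike_pair m a b c d) (cube (Suc m) - {one_vertex (Suc m)}) \<in> corners X (Suc m)"
    (is "?l \<in> _")
proof -
  have b: "b \<in> points X" using spike_in_points[OF X ab] .
  have "(\<lambda>w\<in>cube m. ?l (zero_face i w)) \<in> cubes X m" if i: "i < Suc m" for i
  proof -
    have l: "?l (zero_face i w) = spike_pair m a b c d (zero_face i w)" "zero_face i w \<in> cube (Suc m)"
      if "w \<in> cube m" for w
      using zero_face_neq_one[OF _ i] length_zero_face[OF _ i] that by (auto simp: cube_def)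
    show ?thesis
    proof (cases i)
      case 0
      have "(\<lambda>w\<in>cube m. ?l (zero_face i w)) = spike m a b"
        unfolding spike_def
        by (rule restrict_ext) (use l 0 in \<open>simp add: spike_pair_def zero_face_def\<close>)
      then show ?thesis using ab by simp
    next
      case (Suc i')
      have "(\<lambda>w\<in>cube m. ?l (zero_face i w)) = (\<lambda>w\<in>cube m. if w ! 0 then c else a)"
      proof (rule restrict_ext)
        fix w assume w: "w \<in> cube m"
        have "\<not> tl (zero_face i w) ! i'"
          using nth_zero_face[of w "Suc m" i i] w i l(2)[OF w] Suc by (simp add: nth_tl cube_def)
        then have "tl (zero_face i w) \<noteq> one_vertex m" using i Suc by auto
        moreover have "zero_face i w ! 0 = w ! 0"
          using nth_zero_face[of w "Suc m" i 0] w i Suc by simp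
        ultimately show "?l (zero_face i w) = (if w ! 0 then c else a)"
          using l[OF w] by (simp add: spike_pair_def)
      qed
      then show ?thesis using edge_cube[OF X pts, of 0 m] m by simp
    qed
  qed
  moreover have "?l v \<in> points X" if "v \<in> cube (Suc m) - {one_vertex (Suc m)}" for v
    using that pts b by (auto simp: spike_pair_def one_vertex_Suc_iff)
  ultimately show ?thesis by (auto simp: corners_def)
qed

section \<open>Topology\<close>

lemma lch_nilspaceD:
  assumes "lch_nilspace X T"
  shows "nilspace X" "topspace T = points X" "locally_compact_space T" "Hausdorff_space T"
    "second_countable T" "closedin (product_topology (\<lambda>_. T) (cube n)) (cubes X n)"
    "1 \<le> n \<Longrightarrow> open_map
        (subtopology (product_topology (\<lambda>_. T) (cube n)) (cubes X n))
        (subtopology (product_topology (\<lambda>_. T) (cube n - {one_vertex n})) (corners X n))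
        (\<lambda>c. restrict c (cube n - {one_vertex n}))"
  using assms unfolding lch_nilspace_def by auto

text \<open>Continuity at \<open>(h, h, x)\<close> of the partial, multivalued operation \<open>x0 + b - a\<close>: it follows from
  openness of the corner restriction at the cube \<open>spike_pair m h h x x\<close>.\<close>

lemma spike_pair_completion_near:
  assumes L: "lch_nilspace X T" and m: "1 \<le> m" and h: "h \<in> points X"
    and U: "openin T U" "x \<in> U"
  shows "\<exists>V W. openin T V \<and> h \<in> V \<and> openin T W \<and> x \<in> W \<and>
    (\<forall>a\<in>V. \<forall>b\<in>V. \<forall>x0\<in>W. spike m a b \<in> cubes X m \<longrightarrow>
      (\<exists>x'\<in>U. spike_pair m a b x0 x' \<in> cubes X (Suc m)))"
proof -
  note X = lch_nilspaceD(1)[OF L] and top = lch_nilspaceD(2)[OF L]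
  let ?n = "Suc m" and ?J = "cube (Suc m) - {one_vertex (Suc m)}"
  let ?P = "product_topology (\<lambda>_. T) (cube ?n)" and ?Q = "product_topology (\<lambda>_. T) ?J"
  have x: "x \<in> points X" using U openin_subset top by blast
  define c0 where "c0 = spike_pair m h h x x"
  have "c0 = (\<lambda>v\<in>cube ?n. if v ! 0 then x else h)" by (auto simp: c0_def spike_pair_def)
  then have c0: "c0 \<in> cubes X ?n" using edge_cube[OF X h x, of 0 ?n] by simp
  have c0_one: "c0 (one_vertex ?n) = x"
    using one_vertex_in_cube[of ?n] by (simp add: c0_def spike_pair_def)
  have cubes_top: "cubes X ?n \<subseteq> topspace ?P"
    using cubes_extensional[OF X] top by (auto simp: topspace_product_topology)
  \<comment> \<open>\<open>N\<close> asks that the last value lie in \<open>U\<close>; openness of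
    the corner restriction turns this into the open condition \<open>B\<close> on corners, satisfied
    by the corner of \<open>c0\<close>.\<close>
  define N where "N = {c \<in> topspace ?P. c (one_vertex ?n) \<in> U}"
  have "openin ?P N"
    unfolding N_def
  proof (rule openin_continuous_map_preimage[OF _ U(1)])
    show "continuous_map ?P T (\<lambda>c. c (one_vertex ?n))"
      using continuous_map_product_projection[of "one_vertex ?n" "cube ?n" "\<lambda>_. T"]
      by (simp del: replicate_Suc)
  qed
  then have "openin (subtopology ?P (cubes X ?n)) (N \<inter> cubes X ?n)"
    by (rule openin_subtopology_Int)
  then have "openin (subtopology ?Q (corners X ?n)) ((\<lambda>c. restrict c ?J) ` (N \<inter> cubes X ?n))"
    using lch_nilspaceD(7)[OF L, of ?n] unfolding open_map_def by simp
  then obtain B where B: "openin ?Q B" "(\<lambda>c. restrict c ?J) ` (N \<inter> cubes X ?n) = B \<inter> corners X ?n"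
    unfolding openin_subtopology by blast
  have "c0 \<in> N \<inter> cubes X ?n" using c0 c0_one U cubes_top by (auto simp: N_def)
  then have "restrict c0 ?J \<in> B" using B(2) by blast
  with B(1) have "\<exists>Ob. finite {i \<in> ?J. Ob i \<noteq> topspace T} \<and> (\<forall>v\<in>?J. openin T (Ob v)) \<and>
      restrict c0 ?J \<in> Pi\<^sub>E ?J Ob \<and> Pi\<^sub>E ?J Ob \<subseteq> B"
    unfolding openin_product_topology_alt by (rule bspec)
  then obtain Ob where Ob0: "\<forall>v\<in>?J. openin T (Ob v)"
    and Ob: "restrict c0 ?J \<in> Pi\<^sub>E ?J Ob" "Pi\<^sub>E ?J Ob \<subseteq> B"
    by (elim exE conjE)
  \<comment> \<open>The box around the corner of \<open>c0\<close> is shrunk to one open set per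
    face: \<open>V\<close> serves all vertices of the lower face, where \<open>c0\<close> is
    \<open>h\<close>, and \<open>W\<close> those of the upper face, where it is
    \<open>x\<close>.\<close>
  define V where "V = (\<Inter>v\<in>{v\<in>?J. \<not> v ! 0}. Ob v) \<inter> topspace T"
  define W where "W = (\<Inter>v\<in>{v\<in>?J. v ! 0}. Ob v) \<inter> topspace T"
  have V: "openin T V" unfolding V_def
    by (rule openin_INT) (use finite_cube Ob0 in auto)
  have W: "openin T W" unfolding W_def
    by (rule openin_INT) (use finite_cube Ob0 in auto)
  have c0_Ob: "c0 v \<in> Ob v" if "v \<in> ?J" for v
    using PiE_mem[OF Ob(1) that] that by simp
  have "h \<in> Ob v" if "v \<in> ?J" "\<not> v ! 0" for v
    using c0_Ob[OF that(1)] that by (simp add: c0_def spike_pair_def)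
  then have hV: "h \<in> V" using h top by (simp add: V_def)
  have "x \<in> Ob v" if "v \<in> ?J" "v ! 0" for v
    using c0_Ob[OF that(1)] that by (simp add: c0_def spike_pair_def)
  then have xW: "x \<in> W" using x top by (simp add: W_def)
  have "\<exists>x'\<in>U. spike_pair m a b x0 x' \<in> cubes X ?n"
    if a: "a \<in> V" and b: "b \<in> V" and x0: "x0 \<in> W" and ab: "spike m a b \<in> cubes X m" for a b x0
  proof -
    let ?l = "restrict (spike_pair m a b x0 x0) ?J"
    have "?l \<in> corners X ?n"
      using a x0 top by (intro spike_pair_corner[OF X m ab]) (auto simp: V_def W_def)
    moreover have "?l \<in> Pi\<^sub>E ?J Ob"
    proof (rule restrict_PiE_iff[THEN iffD2], rule ballI)
      fix v assume v: "v \<in> ?J"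
      show "spike_pair m a b x0 x0 v \<in> Ob v"
        using a b x0 v by (cases "v ! 0") (auto simp: V_def W_def spike_pair_def)
    qed
    ultimately have "?l \<in> (\<lambda>c. restrict c ?J) ` (N \<inter> cubes X ?n)" using B(2) Ob(2) by blast
    then obtain c where c: "c \<in> N" "c \<in> cubes X ?n" "?l = restrict c ?J" by blast
    have "c = spike_pair m a b x0 (c (one_vertex ?n))"
    proof (rule PiE_ext)
      show "c \<in> cube ?n \<rightarrow>\<^sub>E UNIV" using cubes_extensional[OF X c(2)] by auto
      show "spike_pair m a b x0 (c (one_vertex ?n)) \<in> cube ?n \<rightarrow>\<^sub>E UNIV"
        by (simp add: spike_pair_def)
      fix v assume v: "v \<in> cube ?n"
      show "c v = spike_pair m a b x0 (c (one_vertex ?n)) v"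
      proof (cases "v = one_vertex ?n")
        case True
        then show ?thesis using one_vertex_Suc_iff[OF v] v by (simp add: spike_pair_def)
      next
        case False
        then have "c v = ?l v" using fun_cong[OF c(3), of v] v by simp
        then show ?thesis using False one_vertex_Suc_iff[OF v] v by (auto simp: spike_pair_def)
      qed
    qed
    moreover have "c (one_vertex ?n) \<in> U" using c(1) by (simp add: N_def)
    ultimately show ?thesis using c(2) by metis
  qed
  then show ?thesis using V W hV xW by blast
qed

text \<open>The class of \<open>a\<close> is the preimage of the closed set of cubes under a
  continuous map. Being closed, it inherits local compactness.\<close>

lemma closedin_spike:
  assumes L: "lch_nilspace X T" and a: "a \<in> points X"
  shows "closedin T {b \<in> topspace T. spike m a b \<in> cubes X m}"
proof (rule closedin_continuous_map_preimage[OF _ lch_nilspaceD(6)[OF L]])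
  have "continuous_map T T (\<lambda>b. spike m a b v)" if "v \<in> cube m" for v
    using that a lch_nilspaceD(2)[OF L] by (cases "v = one_vertex m") (auto simp: spike_def)
  then show "continuous_map T (product_topology (\<lambda>_. T) (cube m)) (spike m a)"
    by (auto simp: continuous_map_componentwise spike_def)
qed

text \<open>Compact neighbourhoods inside the sets \<open>V h\<close> cover \<open>A\<close>, and
  countably many suffice. Their images are compact, hence closed, and cover \<open>B\<close>; by
  Baire one of them has nonempty interior.\<close>

lemma interior_of_image_nonempty:
  assumes "locally_compact_space A" "Hausdorff_space A" "second_countable A"
    and B: "locally_compact_space B" "Hausdorff_space B" "topspace B \<noteq> {}"
    and f: "continuous_map A B f" "f ` topspace A = topspace B"
    and V: "\<And>h. h \<in> topspace A \<Longrightarrow> openin A (V h) \<and> h \<in> V h"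
  shows "\<exists>h\<in>topspace A. B interior_of (f ` V h) \<noteq> {}"
proof (rule ccontr)
  assume "\<not> ?thesis"
  then have empty: "B interior_of (f ` V h) = {}" if "h \<in> topspace A" for h using that by blast
  have "neighbourhood_base_of (compactin A) A"
    using locally_compact_space_neighbourhood_base assms(1,2) by blast
  then have "\<forall>h\<in>topspace A. \<exists>Ob K. openin A Ob \<and> compactin A K \<and> h \<in> Ob \<and> Ob \<subseteq> K \<and> K \<subseteq> V h"
    using V unfolding neighbourhood_base_of by blast
  then obtain Ob K where OK: "\<And>h. h \<in> topspace A \<Longrightarrow>
      openin A (Ob h) \<and> compactin A (K h) \<and> h \<in> Ob h \<and> Ob h \<subseteq> K h \<and> K h \<subseteq> V h"
    by metis
  then have Ob: "openin A (Ob h)" "h \<in> Ob h" "Ob h \<subseteq> K h"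
    and K: "compactin A (K h)" "K h \<subseteq> V h" if "h \<in> topspace A" for h
    using that by simp_all
  have "\<Union>(Ob ` topspace A) = topspace A"
    using Ob(2) openin_subset[OF Ob(1)] by fastforce
  moreover have "\<And>S. S \<in> Ob ` topspace A \<Longrightarrow> openin A S" using Ob(1) by fast
  ultimately obtain \<V> where \<V>: "countable \<V>" "\<V> \<subseteq> Ob ` topspace A" "\<Union>\<V> = topspace A"
    using Lindelof_spaceD[OF second_countable_imp_Lindelof_space[OF assms(3)], of "Ob ` topspace A"]
    by metis
  obtain H where "countable H" "H \<subseteq> topspace A" "\<V> = Ob ` H"
    using \<V>(1,2) countable_subset_image[of \<V> Ob "topspace A"] by blast
  then have H: "countable H" "H \<subseteq> topspace A" "\<Union>(Ob ` H) = topspace A"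
    using \<V>(3) by simp_all
  have "B interior_of \<Union>((\<lambda>h. f ` K h) ` H) = {}"
  proof (rule Baire_category_alt)
    show "completely_metrizable_space B \<or> locally_compact_space B \<and> regular_space B"
      using B locally_compact_Hausdorff_imp_regular_space by blast
    fix S assume "S \<in> (\<lambda>h. f ` K h) ` H"
    then obtain h where h: "h \<in> topspace A" "S = f ` K h" using H(2) by blast
    then have "closedin B S"
      using compactin_imp_closedin[OF B(2)] image_compactin[OF K(1)[OF h(1)] f(1)] by simp
    moreover have "B interior_of S \<subseteq> B interior_of (f ` V h)"
      unfolding h(2) by (intro interior_of_mono image_mono K(2)[OF h(1)])
    ultimately show "closedin B S \<and> B interior_of S = {}" using empty[OF h(1)] by blast
  qed (use H in simp)
  moreover have "\<Union>((\<lambda>h. f ` K h) ` H) = topspace B"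
  proof
    show "\<Union>((\<lambda>h. f ` K h) ` H) \<subseteq> topspace B"
      using H(2) K(1) f(2) compactin_subset_topspace by fast
    have "topspace A \<subseteq> (\<Union>h\<in>H. K h)"
    proof
      fix z assume "z \<in> topspace A"
      then obtain h where "h \<in> H" "z \<in> Ob h" using H(3) by blast
      then show "z \<in> (\<Union>h\<in>H. K h)" using Ob(3)[of h] H(2) by blast
    qed
    then have "f ` topspace A \<subseteq> f ` (\<Union>h\<in>H. K h)" by (rule image_mono)
    then show "topspace B \<subseteq> \<Union>((\<lambda>h. f ` K h) ` H)" using f(2) by (simp add: image_UN)
  qed
  ultimately show False using B(3) by simp
qed

section \<open>Openness modulo the relations of the factors\<close>

text \<open>Openness up to the relation: the saturation of the image of an open set is a
  neighbourhood of that image. This form avoids the quotient of \<open>Y\<close>.\<close>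

definition open_mod_spike ::
    "'a topology \<Rightarrow> 'b cubespace \<Rightarrow> 'b topology \<Rightarrow> ('a \<Rightarrow> 'b) \<Rightarrow> nat \<Rightarrow> bool" where
  "open_mod_spike TX Y TY f m \<longleftrightarrow> (\<forall>U x. openin TX U \<longrightarrow> x \<in> U \<longrightarrow>
     (\<exists>W. openin TY W \<and> f x \<in> W \<and> (\<forall>y\<in>W. \<exists>x'\<in>U. spike m (f x') y \<in> cubes Y m)))"

lemma open_mod_spike_Suc:
  assumes LX: "lch_nilspace X TX" and LY: "lch_nilspace Y TY"
    and fib: "fibration X Y f" and cont: "continuous_map TX TY f"
    and m: "1 \<le> m" and IH: "open_mod_spike TX Y TY f m"
  shows "open_mod_spike TX Y TY f (Suc m)"
  unfolding open_mod_spike_def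
proof (intro allI impI)
  fix U x assume U: "openin TX U" "x \<in> U"
  note X = lch_nilspaceD(1)[OF LX] and topX = lch_nilspaceD(2)[OF LX]
  note Y = lch_nilspaceD(1)[OF LY] and topY = lch_nilspaceD(2)[OF LY]
  have mor: "nil_morphism X Y f" using fib by (simp add: fibration_def)
  have x: "x \<in> points X" using U openin_subset topX by blast
  have fY: "f z \<in> points Y" if "z \<in> points X" for z
    using mor that by (auto simp: nil_morphism_def)
  let ?p = "f x"
  define G where "G = {h \<in> topspace TX. spike m x h \<in> cubes X m}"
  define F where "F = {q \<in> topspace TY. spike m ?p q \<in> cubes Y m}"
  have clG: "closedin TX G" unfolding G_def by (rule closedin_spike[OF LX x])
  have clF: "closedin TY F" unfolding F_def by (rule closedin_spike[OF LY fY[OF x]])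
  have G_spike: "spike m a b \<in> cubes X m" if "a \<in> G" "b \<in> G" for a b
    using that spike_trans[OF X] by (auto simp: G_def)
  have "f ` G = F"
  proof
    show "f ` G \<subseteq> F"
      using nil_morphism_spike[OF mor] fY topX topY by (auto simp: G_def F_def)
    show "F \<subseteq> f ` G"
    proof
      fix q assume q: "q \<in> F"
      \<comment> \<open>The spike from \<open>?p\<close> to \<open>q\<close> extends the image of
        the corner constant at \<open>x\<close>; lifting it gives a spike at \<open>x\<close> with
        tip over \<open>q\<close>.\<close>
      let ?J = "cube m - {one_vertex m}"
      let ?l = "restrict (\<lambda>v\<in>cube m. x) ?J"
      have "?l \<in> corners X m" by (rule corner_of_cube[OF X const_cube[OF X x]])
      moreover have "spike m ?p q \<in> cubes Y m" using q by (simp add: F_def)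
      moreover have "\<forall>v\<in>?J. spike m ?p q v = f (?l v)" by (simp add: spike_def)
      ultimately obtain c where c: "c \<in> cubes X m" "\<And>v. v \<in> ?J \<Longrightarrow> c v = ?l v"
        "\<And>v. v \<in> cube m \<Longrightarrow> f (c v) = spike m ?p q v"
        using fib m unfolding fibration_def by blast
      have "c = spike m x (c (one_vertex m))"
      proof (rule PiE_ext)
        show "c \<in> cube m \<rightarrow>\<^sub>E UNIV" using cubes_extensional[OF X c(1)] by auto
        show "spike m x (c (one_vertex m)) \<in> cube m \<rightarrow>\<^sub>E UNIV" by (simp add: spike_def)
        show "c v = spike m x (c (one_vertex m)) v" if "v \<in> cube m" for v
          using c(2)[of v] that by (simp add: spike_def)
      qed
      then have "spike m x (c (one_vertex m)) \<in> cubes X m" using c(1) by simp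
      then have "c (one_vertex m) \<in> G" using spike_in_points[OF X] topX by (simp add: G_def)
      moreover have "f (c (one_vertex m)) = q" using c(3)[OF one_vertex_in_cube] by (simp add: spike_def)
      ultimately show "q \<in> f ` G" by blast
    qed
  qed
  \<comment> \<open>Around each \<open>h\<close>, differences of related points of
    \<open>V h\<close> can be transported to any base point in \<open>W h\<close> with a result
    inside \<open>U\<close>.\<close>
  have near: "\<forall>h\<in>G. \<exists>V W. openin TX V \<and> h \<in> V \<and> openin TX W \<and> x \<in> W \<and>
    (\<forall>a\<in>V. \<forall>b\<in>V. \<forall>x0\<in>W. spike m a b \<in> cubes X m \<longrightarrow>
      (\<exists>x'\<in>U. spike_pair m a b x0 x' \<in> cubes X (Suc m)))"
    using spike_pair_completion_near[OF LX m _ U] topX by (auto simp: G_def)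
  then obtain V W where VW: "\<And>h. h \<in> G \<Longrightarrow> openin TX (V h) \<and> h \<in> V h \<and> openin TX (W h) \<and> x \<in> W h \<and>
    (\<forall>a\<in>V h. \<forall>b\<in>V h. \<forall>x0\<in>W h. spike m a b \<in> cubes X m \<longrightarrow>
      (\<exists>x'\<in>U. spike_pair m a b x0 x' \<in> cubes X (Suc m)))"
    by metis
  let ?A = "subtopology TX G" and ?B = "subtopology TY F"
  have topA: "topspace ?A = G" and topB: "topspace ?B = F"
    using closedin_subset[OF clG] closedin_subset[OF clF] by auto
  have "?p \<in> F" using fY[OF x] topY spike_refl[OF Y] by (simp add: F_def)
  have "\<exists>h\<in>topspace ?A. ?B interior_of (f ` (V h \<inter> G)) \<noteq> {}"
  proof (rule interior_of_image_nonempty)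
    show "locally_compact_space ?A" "locally_compact_space ?B"
      using locally_compact_space_closed_subset lch_nilspaceD(3)[OF LX] lch_nilspaceD(3)[OF LY] clG clF
      by blast+
    show "Hausdorff_space ?A" "Hausdorff_space ?B"
      using Hausdorff_space_subtopology lch_nilspaceD(4)[OF LX] lch_nilspaceD(4)[OF LY] by blast+
    show "second_countable ?A"
      using second_countable_subtopology lch_nilspaceD(5)[OF LX] by blast
    show "topspace ?B \<noteq> {}" using topB \<open>?p \<in> F\<close> by blast
    show "f ` topspace ?A = topspace ?B" using topA topB \<open>f ` G = F\<close> by simp
    show "continuous_map ?A ?B f"
      using cont \<open>f ` G = F\<close> topA
      by (metis continuous_map_from_subtopology continuous_map_in_subtopology image_subset_iff_funcset order_refl)
    show "openin ?A (V h \<inter> G) \<and> h \<in> V h \<inter> G" if "h \<in> topspace ?A" for h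
      using VW[of h] that topA openin_subtopology_Int by auto
  qed
  then obtain j where j: "j \<in> G" "?B interior_of (f ` (V j \<inter> G)) \<noteq> {}" using topA by auto
  obtain N where N: "openin TY N" "?B interior_of (f ` (V j \<inter> G)) = N \<inter> F"
    using openin_interior_of[of ?B "f ` (V j \<inter> G)"] unfolding openin_subtopology by blast
  have NF: "N \<inter> F \<subseteq> f ` (V j \<inter> G)" using N(2) interior_of_subset by metis
  obtain a where a: "a \<in> V j" "a \<in> G" "f a \<in> N" using j(2) N(2) NF by blast
  have fa: "f a \<in> points Y" "spike m ?p (f a) \<in> cubes Y m"
    using a(2) \<open>f ` G = F\<close> topY by (auto simp: F_def)
  \<comment> \<open>The same continuity in \<open>Y\<close>, now with target \<open>N\<close> around
    \<open>f a\<close>: small differences near \<open>?p\<close> carry over to \<open>f a\<close>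
    without leaving \<open>N\<close>.\<close>
  obtain V' W' where V': "openin TY V'" "?p \<in> V'" "f a \<in> W'"
    and V'W': "\<And>y0 y. y0 \<in> V' \<Longrightarrow> y \<in> V' \<Longrightarrow> spike m y0 y \<in> cubes Y m \<Longrightarrow>
        \<exists>q\<in>N. spike_pair m y0 y (f a) q \<in> cubes Y (Suc m)"
    using spike_pair_completion_near[OF LY m fY[OF x] N(1) a(3)] by blast
  \<comment> \<open>Two constraints on \<open>x0\<close>: membership in \<open>W j\<close> for the
    transport back in \<open>X\<close>, and \<open>f x0\<close> in \<open>V'\<close> for the
    transport to \<open>f a\<close> in \<open>Y\<close>.\<close>
  have "openin TX {z \<in> topspace TX. f z \<in> V'}"
    by (rule openin_continuous_map_preimage[OF cont V'(1)])
  then have "openin TX (W j \<inter> {z \<in> topspace TX. f z \<in> V'})" using VW[OF j(1)] by blast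
  moreover have "x \<in> W j \<inter> {z \<in> topspace TX. f z \<in> V'}" using VW[OF j(1)] V' x topX by simp
  ultimately obtain W0 where W0: "openin TY W0" "?p \<in> W0"
    "\<And>y. y \<in> W0 \<Longrightarrow> \<exists>x0\<in>W j \<inter> {z \<in> topspace TX. f z \<in> V'}. spike m (f x0) y \<in> cubes Y m"
    using IH unfolding open_mod_spike_def by meson
  have "\<exists>x'\<in>U. spike (Suc m) (f x') y \<in> cubes Y (Suc m)" if y: "y \<in> W0 \<inter> V'" for y
  proof -
    obtain x0 where x0: "x0 \<in> W j" "f x0 \<in> V'" "spike m (f x0) y \<in> cubes Y m"
      using W0(3) y by blast
    obtain q where q: "q \<in> N" "spike_pair m (f x0) y (f a) q \<in> cubes Y (Suc m)"
      using V'W'[OF x0(2) _ x0(3)] y by blast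
    have aq: "spike m (f a) q \<in> cubes Y m" by (rule spike_pair_top[OF Y q(2)])
    have "spike m (f a) ?p \<in> cubes Y m"
      using spike_trans[OF Y fa(2) spike_refl[OF Y fY[OF x]]] .
    then have "spike m ?p q \<in> cubes Y m" using spike_trans[OF Y _ aq] by blast
    then have "q \<in> N \<inter> F" using q(1) spike_in_points[OF Y aq] topY by (simp add: F_def)
    then obtain b where b: "b \<in> V j" "b \<in> G" "f b = q" using NF by blast
    obtain x' where x': "x' \<in> U" "spike_pair m a b x0 x' \<in> cubes X (Suc m)"
      using VW[OF j(1)] a b x0(1) G_spike[OF a(2) b(2)] by blast
    \<comment> \<open>Both \<open>f x'\<close> and \<open>y\<close> complete the parallelogram on
      \<open>f a\<close>, \<open>q\<close> and \<open>f x0\<close>, so they agree up to the relation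
      of order \<open>m\<close>.\<close>
    have "spike_pair m (f a) q (f x0) (f x') \<in> cubes Y (Suc m)"
      using nil_morphism_spike_pair[OF mor x'(2)] b(3) by simp
    then have "spike (Suc m) (f x') y \<in> cubes Y (Suc m)"
      using spike_of_spike_pairs[OF Y _ spike_pair_swap[OF Y q(2)]] by blast
    then show ?thesis using x'(1) by blast
  qed
  then show "\<exists>W. openin TY W \<and> ?p \<in> W \<and> (\<forall>y\<in>W. \<exists>x'\<in>U. spike (Suc m) (f x') y \<in> cubes Y (Suc m))"
    using W0(1,2) V'(1,2) by (intro exI[of _ "W0 \<inter> V'"]) auto
qed

text \<open>The spike and the constant cube at \<open>a\<close> complete the same
  \<open>(k + 1)\<close>-corner, and in a \<open>k\<close>-step nilspace the completion is
  unique.\<close>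

lemma spike_step_eq:
  assumes S: "step_nilspace k Y" and a: "a \<in> points Y" and ab: "spike (k + 1) a b \<in> cubes Y (k + 1)"
  shows "a = b"
proof -
  have Y: "nilspace Y" using S by (simp add: step_nilspace_def)
  let ?J = "cube (k + 1) - {one_vertex (k + 1)}"
  let ?l = "restrict (spike (k + 1) a b) ?J"
  have "?l \<in> corners Y (k + 1)" by (rule corner_of_cube[OF Y ab])
  then have "\<exists>!c. c \<in> cubes Y (k + 1) \<and> (\<forall>v\<in>?J. c v = ?l v)"
    using S unfolding step_nilspace_def by blast
  moreover have "spike (k + 1) a a \<in> cubes Y (k + 1)" by (rule spike_refl[OF Y a])
  moreover have "\<forall>v\<in>?J. spike (k + 1) a a v = ?l v" "\<forall>v\<in>?J. spike (k + 1) a b v = ?l v"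
    by (auto simp: spike_def)
  ultimately have "spike (k + 1) a a = spike (k + 1) a b" using ab by blast
  then have "spike (k + 1) a a (one_vertex (k + 1)) = spike (k + 1) a b (one_vertex (k + 1))" by simp
  then show ?thesis unfolding spike_def using one_vertex_in_cube[of "k + 1"] by simp
qed

theorem theorem2p23:
  fixes k :: nat
    and X :: "'a cubespace" and TX :: "'a topology"
    and Y :: "'b cubespace" and TY :: "'b topology"
    and \<phi> :: "'a \<Rightarrow> 'b"
  assumes "step_nilspace k X" and "lch_nilspace X TX"
    and "lie_fibered k Y TY"
    and "fibration X Y \<phi>" and "continuous_map TX TY \<phi>"
  shows "open_map TX TY \<phi>"
proof -
  have LY: "lch_nilspace Y TY" and SY: "step_nilspace k Y"
    using assms(3) by (auto simp: lie_fibered_def)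
  note Y = lch_nilspaceD(1)[OF LY] and topY = lch_nilspaceD(2)[OF LY]
  have fY: "\<phi> z \<in> topspace TY" if "z \<in> topspace TX" for z
    using assms(5) that by (auto simp: continuous_map_def)
  have "open_mod_spike TX Y TY \<phi> (Suc m)" for m
  proof (induction m)
    case 0
    have "spike 1 (\<phi> x) y \<in> cubes Y 1" if "openin TX U" "x \<in> U" "y \<in> topspace TY" for U x y
      using spike_one[OF Y] that openin_subset[OF that(1)] fY topY by blast
    then show ?case
      unfolding open_mod_spike_def using fY openin_subset by (metis One_nat_def openin_topspace subsetD)
  next
    case (Suc m)
    show ?case by (rule open_mod_spike_Suc[OF assms(2) LY assms(4,5) _ Suc]) simp
  qed
  then have final: "open_mod_spike TX Y TY \<phi> (k + 1)" by simp
  show ?thesis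
    unfolding open_map_def
  proof (intro allI impI)
    fix U assume U: "openin TX U"
    show "openin TY (\<phi> ` U)"
    proof (subst openin_subopen, intro ballI)
      fix p assume "p \<in> \<phi> ` U"
      then obtain x where x: "x \<in> U" "p = \<phi> x" by blast
      obtain W where W: "openin TY W" "\<phi> x \<in> W"
        "\<And>y. y \<in> W \<Longrightarrow> \<exists>x'\<in>U. spike (k + 1) (\<phi> x') y \<in> cubes Y (k + 1)"
        using final U x(1) unfolding open_mod_spike_def by meson
      have "\<phi> x' \<in> points Y" if "x' \<in> U" for x' using that fY topY openin_subset[OF U] by blast
      then have "W \<subseteq> \<phi> ` U" using W(3) spike_step_eq[OF SY] by blast
      then show "\<exists>T. openin TY T \<and> p \<in> T \<and> T \<subseteq> \<phi> ` U" using W x by blast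
    qed
  qed
qed

end
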